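(* Let $\mathcal X=\mathbb R^n$ or let $\mathcal X\subseteq\mathbb R^n$ be closed, bounded and convex. For $t\in\mathbb N_0$ let $x^{(t)}\in\mathcal X$, $\Delta^{(t)}>0$, and let the surrogates $m^{(t)}=(m^{(t)}_1,\dots,m^{(t)}_k):\mathbb R^n\to\mathbb R^k$ be twice continuously differentiable on an open set containing $\mathcal X$. Let $i^{(t)}_\ell=\min_{x\in\mathcal X}m^{(t)}_\ell(x)$ for $\ell=1,\dots,k$ (assumed to exist) and $r^{(t)}=m^{(t)}(x^{(t)})-(i^{(t)}_1,\dots,i^{(t)}_k)^T\in\mathbb R^k_{\ge0}$. Suppose there is a constant $\mathrm r\in(0,1]$ such that, whenever $x^{(t)}$ is not Pareto-critical for $\min_{x\in B^{(t)}}m^{(t)}(x)$, the components of $r^{(t)}$ satisfy $$\frac{\min_\ell r^{(t)}_\ell}{\max_\ell r^{(t)}_\ell}\ge\mathrm r .$$ Let $(\tau^+,x^{(t)}_+)$ be a solution of $$\min_{\tau\in\mathbb R,\ x\in B^{(t)}}\ \tau\quad\text{s.t.}\quad m^{(t)}(x^{(t)})+\tau r^{(t)}-m^{(t)}(x)\ge0\ \text{ (componentwise)}.$$ Then there exists a constant $\tilde\kappa_{\mathrm m}\in(0,1)$, independent of $t$, such that $$\Phi^{(t)}_{\mathrm m}(x^{(t)})-\Phi^{(t)}_{\mathrm m}(x^{(t)}_+)\ \ge\ \tilde\kappa_{\mathrm m}\,\omega^{(t)}_{\mathrm m}(x^{(t)})\min\left\{\frac{\omega^{(t)}_{\mathrm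 m}(x^{(t)})}{\mathrm c\,H^{(t)}_{\mathrm m}},\ \Delta^{(t)},\ 1\right\}.$$
   Context: $\|\cdot\|=\|\cdot\|_\infty$; $B^{(t)}=\{x\in\mathcal X:\|x-x^{(t)}\|\le\Delta^{(t)}\}$; $\Phi^{(t)}_{\mathrm m}(x)=\max_\ell m^{(t)}_\ell(x)$; $\omega^{(t)}_{\mathrm m}(x)=-\min\{\max_\ell\langle\nabla m^{(t)}_\ell(x),d\rangle:d\in\mathcal X-x,\ \|d\|\le1\}$; $H^{(t)}_{\mathrm m}=\max_\ell\max_{x\in B^{(t)}}\|\nabla^2m^{(t)}_\ell(x)\|_F$ (Frobenius norm of the Hessian); $\mathrm c>0$ is a constant with $\|x\|_2\le\sqrt{\mathrm c}\,\|x\|$ for all $x\in\mathbb R^n$. If $H^{(t)}_{\mathrm m}=0$ the quotient is read as $+\infty$. $x^{(t)}$ is Pareto-critical for $\min_{x\in B^{(t)}}m^{(t)}(x)$ iff there is no $d\in B^{(t)}-x^{(t)}$ with $\max_\ell\langle\nabla m^{(t)}_\ell(x^{(t)}),d\rangle<0$ (equivalently $\omega^{(t)}_{\mathrm m}(x^{(t)})=0$). *)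

theory Defs
  imports "HOL-Analysis.Analysis"
begin

definition grad :: "(real ^ 'n \<Rightarrow> real) \<Rightarrow> real ^ 'n \<Rightarrow> real ^ 'n" where
  "grad f x = (\<chi> i. frechet_derivative f (at x) (axis i 1))"

definition hessian :: "(real ^ 'n \<Rightarrow> real) \<Rightarrow> real ^ 'n \<Rightarrow> real ^ 'n ^ 'n" where
  "hessian f x = matrix (frechet_derivative (grad f) (at x))"

text \<open>Meant for open \<open>U\<close>. A map into \<open>\<real>\<^sup>k\<close> is twice continuously differentiable iff all its
  components are.\<close>

definition C2_on :: "(real ^ 'n) set \<Rightarrow> (real ^ 'n \<Rightarrow> real ^ 'k) \<Rightarrow> bool" where
  "C2_on U f \<longleftrightarrow>
     (\<forall>l. (\<forall>x\<in>U. (\<lambda>y. f y $ l) differentiable (at x))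
        \<and> (\<forall>x\<in>U. grad (\<lambda>y. f y $ l) differentiable (at x))
        \<and> continuous_on U (hessian (\<lambda>y. f y $ l)))"

definition trust_region :: "(real ^ 'n) set \<Rightarrow> real ^ 'n \<Rightarrow> real \<Rightarrow> (real ^ 'n) set" where
  "trust_region X x \<Delta> = {y \<in> X. infnorm (y - x) \<le> \<Delta>}"

definition max_component :: "(real ^ 'n \<Rightarrow> real ^ 'k) \<Rightarrow> real ^ 'n \<Rightarrow> real" where
  "max_component f x = (MAX l. f x $ l)"

definition max_slope :: "(real ^ 'n \<Rightarrow> real ^ 'k) \<Rightarrow> real ^ 'n \<Rightarrow> real ^ 'n \<Rightarrow> real" where
  "max_slope f x d = (MAX l. grad (\<lambda>y. f y $ l) x \<bullet> d)"

text \<open>Minima and maxima over sets that need not be finite are written with \<open>LEAST\<close> and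
  \<open>GREATEST\<close>, which are unspecified if the extremum is not attained.\<close>

definition criticality :: "(real ^ 'n) set \<Rightarrow> (real ^ 'n \<Rightarrow> real ^ 'k) \<Rightarrow> real ^ 'n \<Rightarrow> real" where
  "criticality X f x =
     - (LEAST v. v \<in> max_slope f x ` {d. x + d \<in> X \<and> infnorm d \<le> 1})"

text \<open>The norm of type \<open>real ^ 'n ^ 'n\<close> is the Frobenius norm.\<close>

definition hessian_bound :: "(real ^ 'n) set \<Rightarrow> (real ^ 'n \<Rightarrow> real ^ 'k) \<Rightarrow> real" where
  "hessian_bound B f =
     (MAX l. GREATEST h. h \<in> (\<lambda>x. norm (hessian (\<lambda>y. f y $ l) x)) ` B)"

definition pareto_critical :: "(real ^ 'n) set \<Rightarrow> (real ^ 'n \<Rightarrow> real ^ 'k) \<Rightarrow> real ^ 'n \<Rightarrow> bool" where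
  "pareto_critical B f x \<longleftrightarrow> \<not> (\<exists>d. x + d \<in> B \<and> max_slope f x d < 0)"

definition ideal_point :: "(real ^ 'n) set \<Rightarrow> (real ^ 'n \<Rightarrow> real ^ 'k) \<Rightarrow> real ^ 'k" where
  "ideal_point X f = (\<chi> l. LEAST v. v \<in> (\<lambda>y. f y $ l) ` X)"

text \<open>\<open>(\<tau>, y)\<close> is a global solution of the Pascoletti--Serafini problem on \<open>B\<close> with reference
  point \<open>f x\<close> and direction \<open>r\<close>. The order on \<open>real ^ 'k\<close> is componentwise.\<close>

definition PS_solution ::
  "(real ^ 'n) set \<Rightarrow> (real ^ 'n \<Rightarrow> real ^ 'k) \<Rightarrow> real ^ 'n \<Rightarrow> real ^ 'k \<Rightarrow> real \<times> (real ^ 'n) \<Rightarrow> bool" where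
  "PS_solution B f x r =
     is_arg_min fst (\<lambda>(\<tau>, y). y \<in> B \<and> f x + \<tau> *\<^sub>R r - f y \<ge> 0)"

text \<open>\<open>min {\<omega> / (c H), \<Delta>, 1}\<close>, where the quotient counts as \<open>+\<infinity>\<close> if \<open>H = 0\<close>.\<close>

definition step_bound :: "real \<Rightarrow> real \<Rightarrow> real \<Rightarrow> real \<Rightarrow> real" where
  "step_bound \<omega> c H \<Delta> = Min (if H = 0 then {\<Delta>, 1} else {\<omega> / (c * H), \<Delta>, 1})"

end

theory Submission
  imports Defs
begin

text \<open>
  The ideal point makes \<open>r\<close> nonnegative, so \<open>\<tau> = 0\<close> is feasible and no component increases.
  If \<open>\<omega> > 0\<close>, let \<open>d\<close> attain the criticality. For the step length
  \<open>s = min {\<omega> / (c H), \<Delta>, 1}\<close>, Taylor expansion along \<open>d\<close> gives a decrease of at least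
  \<open>a = s \<omega> / 2\<close> in all components, because \<open>\<parallel>d\<parallel>\<^sub>2\<^sup>2 \<le> c\<close>. Thus
  \<open>(- a / max r, x + s d)\<close> is feasible, so \<open>\<tau> \<le> - a / max r\<close>, and the bound on \<open>min r / max r\<close>
  turns this into a decrease of at least \<open>\<rho> a\<close> in every component. Hence \<open>\<kappa> = \<rho> / 2\<close> works.
\<close>

section \<open>Compactness and attained extrema\<close>

lemma continuous_on_Max_image:
  fixes f :: "'i \<Rightarrow> 'a::topological_space \<Rightarrow> real"
  assumes "finite A" "A \<noteq> {}" "\<And>i. i \<in> A \<Longrightarrow> continuous_on S (f i)"
  shows "continuous_on S (\<lambda>x. MAX i\<in>A. f i x)"
  using assms by (induction rule: finite_ne_induct) (auto intro!: continuous_on_max)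

text \<open>Compactness comes from the ball, since \<open>X\<close> may be the whole space;
  \<open>norm_le_infnorm\<close> bounds the ball in the Euclidean norm.\<close>

lemma compact_Int_infnorm_ball:
  fixes X :: "(real ^ 'n) set"
  assumes "closed X"
  shows "compact {y \<in> X. infnorm (y - x) \<le> e}"
proof -
  have "closed {y :: real ^ 'n. infnorm (y - x) \<le> e}"
    by (intro closed_Collect_le continuous_intros)
  moreover have "bounded {y :: real ^ 'n. infnorm (y - x) \<le> e}"
    unfolding bounded_def
  proof (intro exI ballI)
    fix y assume "y \<in> {y :: real ^ 'n. infnorm (y - x) \<le> e}"
    then have "sqrt DIM(real ^ 'n) * infnorm (y - x) \<le> sqrt DIM(real ^ 'n) * e"
      by (intro mult_left_mono) auto
    with norm_le_infnorm[of "y - x"] show "dist x y \<le> sqrt DIM(real ^ 'n) * e"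
      unfolding dist_norm norm_minus_commute[of x y] by (rule order_trans)
  qed
  ultimately have "compact {y :: real ^ 'n. infnorm (y - x) \<le> e}"
    by (simp add: compact_eq_bounded_closed)
  then have "compact (X \<inter> {y. infnorm (y - x) \<le> e})"
    using assms by (rule closed_Int_compact[rotated])
  then show ?thesis
    by (simp add: Int_def)
qed

text \<open>\<open>LEAST\<close> is specified only for attained minima; a minimiser gives access to
  the values of \<open>ideal_point\<close> and \<open>criticality\<close>.\<close>

lemma LEAST_image:
  fixes f :: "'a \<Rightarrow> real"
  assumes "y \<in> S" "\<And>z. z \<in> S \<Longrightarrow> f y \<le> f z"
  shows "(LEAST v. v \<in> f ` S) = f y"
  using assms by (intro Least_equality) auto

lemma GREATEST_image:
  fixes f :: "'a \<Rightarrow> real"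
  assumes "y \<in> S" "\<And>z. z \<in> S \<Longrightarrow> f z \<le> f y"
  shows "(GREATEST v. v \<in> f ` S) = f y"
  using assms by (intro Greatest_equality) auto

section \<open>Gradients, Hessians and a second-order Taylor bound\<close>

lemma norm_matrix_vector_mult_le:
  fixes A :: "real ^ 'n ^ 'm"
  shows "norm (A *v v) \<le> norm A * norm v"
proof -
  \<comment> \<open>The Frobenius norm is the \<open>L2_set\<close> norm of the row norms, so
    Cauchy-Schwarz on each row suffices.\<close>
  have "norm (A *v v) \<le> L2_set (\<lambda>i. norm (A $ i) * norm v) UNIV"
    unfolding norm_vec_def[of "A *v v"]
    by (intro L2_set_mono)
       (auto simp: matrix_vector_mul_component Cauchy_Schwarz_ineq2)
  also have "\<dots> = norm A * norm v"
    by (simp add: L2_set_left_distrib norm_vec_def)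
  finally show ?thesis .
qed

lemma has_derivative_grad:
  fixes f :: "real ^ 'n \<Rightarrow> real"
  assumes "f differentiable at x"
  shows "(f has_derivative (\<lambda>d. grad f x \<bullet> d)) (at x)"
proof -
  define f' where "f' = frechet_derivative f (at x)"
  have f': "(f has_derivative f') (at x)"
    using assms unfolding f'_def by (simp add: frechet_derivative_works)
  then have lin: "linear f'"
    by (rule has_derivative_linear)
  have "f' d = grad f x \<bullet> d" for d
  proof -
    \<comment> \<open>A linear map is determined by its values on the axis vectors, here the entries
      of \<open>grad f x\<close>.\<close>
    have "f' d = f' (\<Sum>i\<in>UNIV. d $ i *s axis i 1)"
      by (simp add: basis_expansion)
    also have "\<dots> = (\<Sum>i\<in>UNIV. d $ i * f' (axis i 1))"
      by (simp add: linear_sum[OF lin] linear_cmul[OF lin] scalar_mult_eq_scaleR)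
    also have "\<dots> = grad f x \<bullet> d"
      by (simp add: grad_def f'_def inner_vec_def mult.commute)
    finally show ?thesis .
  qed
  then show ?thesis
    using f' by (metis ext)
qed

lemma has_derivative_hessian:
  fixes f :: "real ^ 'n \<Rightarrow> real"
  assumes "grad f differentiable at x"
  shows "(grad f has_derivative (\<lambda>d. hessian f x *v d)) (at x)"
proof -
  have "(grad f has_derivative frechet_derivative (grad f) (at x)) (at x)"
    using assms by (simp add: frechet_derivative_works)
  moreover from this have "linear (frechet_derivative (grad f) (at x))"
    by (rule has_derivative_linear)
  ultimately show ?thesis
    unfolding hessian_def by (simp add: matrix_works)
qed

text \<open>Taylor's theorem with Lagrange remainder for the restriction of \<open>f\<close> to the
  segment; Cauchy-Schwarz and the Hessian bound control the remainder at the unknown intermediate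
  point.\<close>

lemma second_order_upper_bound:
  fixes f :: "real ^ 'n \<Rightarrow> real"
  assumes f: "\<And>u. 0 \<le> u \<Longrightarrow> u \<le> s \<Longrightarrow> f differentiable at (x + u *\<^sub>R d)"
    and g: "\<And>u. 0 \<le> u \<Longrightarrow> u \<le> s \<Longrightarrow> grad f differentiable at (x + u *\<^sub>R d)"
    and H: "\<And>u. 0 \<le> u \<Longrightarrow> u \<le> s \<Longrightarrow> norm (hessian f (x + u *\<^sub>R d)) \<le> H"
    and "0 < s"
  shows "f (x + s *\<^sub>R d) \<le> f x + s * (grad f x \<bullet> d) + s\<^sup>2 / 2 * (H * (norm d)\<^sup>2)"
proof -
  \<comment> \<open>The derivatives of the restriction by order, in the form
    \<open>Maclaurin2\<close> expects; only orders 0, 1 and 2 matter.\<close>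
  define D where "D = (\<lambda>k::nat. \<lambda>u.
    if k = 0 then f (x + u *\<^sub>R d)
    else if k = 1 then grad f (x + u *\<^sub>R d) \<bullet> d
    else (hessian f (x + u *\<^sub>R d) *v d) \<bullet> d)"
  have line: "((\<lambda>u. x + u *\<^sub>R d) has_derivative (\<lambda>h. h *\<^sub>R d)) (at u)" for u
    by (auto intro!: derivative_eq_intros)
  have D: "\<forall>k u. k < 2 \<and> 0 \<le> u \<and> u \<le> s \<longrightarrow> (D k has_real_derivative D (Suc k) u) (at u)"
  proof (intro allI impI, elim conjE)
    fix k :: nat and u :: real
    assume k: "k < 2" and u: "0 \<le> u" "u \<le> s"
    have "((\<lambda>u. f (x + u *\<^sub>R d)) has_derivative (\<lambda>h. grad f (x + u *\<^sub>R d) \<bullet> (h *\<^sub>R d))) (at u)"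
      by (rule has_derivative_compose[OF line has_derivative_grad[OF f[OF u]]])
    then have D0: "(D 0 has_real_derivative D 1 u) (at u)"
      unfolding D_def has_field_derivative_def by (simp add: mult_commute_abs)
    have "((\<lambda>u. grad f (x + u *\<^sub>R d)) has_derivative
        (\<lambda>h. hessian f (x + u *\<^sub>R d) *v (h *\<^sub>R d))) (at u)"
      by (rule has_derivative_compose[OF line has_derivative_hessian[OF g[OF u]]])
    then have "((\<lambda>u. grad f (x + u *\<^sub>R d) \<bullet> d) has_derivative
        (\<lambda>h. (hessian f (x + u *\<^sub>R d) *v (h *\<^sub>R d)) \<bullet> d)) (at u)"
      by (rule has_derivative_inner_left)
    then have D1: "(D 1 has_real_derivative D 2 u) (at u)"
      unfolding D_def has_field_derivative_def
      by (simp add: matrix_vector_mult_scaleR mult_commute_abs)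
    from k have "k = 0 \<or> k = 1" by auto
    with D0 D1 show "(D k has_real_derivative D (Suc k) u) (at u)"
      by (auto simp: numeral_2_eq_2)
  qed
  obtain u where u: "0 < u" "u \<le> s"
    and eq: "f (x + s *\<^sub>R d) = (\<Sum>k<2. D k 0 / fact k * s ^ k) + D 2 u / fact 2 * s ^ 2"
    using Maclaurin2[of s D "\<lambda>u. f (x + u *\<^sub>R d)" 2] D \<open>0 < s\<close>
    by (auto simp: D_def)
  have "D 2 u = (hessian f (x + u *\<^sub>R d) *v d) \<bullet> d"
    by (simp add: D_def)
  also have "\<dots> \<le> norm (hessian f (x + u *\<^sub>R d) *v d) * norm d"
    by (rule norm_cauchy_schwarz)
  also have "\<dots> \<le> (norm (hessian f (x + u *\<^sub>R d)) * norm d) * norm d"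
    by (intro mult_right_mono norm_matrix_vector_mult_le) auto
  also have "\<dots> \<le> (H * norm d) * norm d"
    using H[of u] u by (intro mult_right_mono) auto
  finally have "D 2 u \<le> H * (norm d)\<^sup>2"
    by (simp add: power2_eq_square mult.assoc)
  then have "s\<^sup>2 / 2 * D 2 u \<le> s\<^sup>2 / 2 * (H * (norm d)\<^sup>2)"
    by (rule mult_left_mono) simp
  moreover have "f (x + s *\<^sub>R d) = f x + s * (grad f x \<bullet> d) + s\<^sup>2 / 2 * D 2 u"
    using eq by (simp add: numeral_2_eq_2 D_def)
  ultimately show ?thesis
    by simp
qed

section \<open>Ideal point, criticality and Hessian bound as attained extrema\<close>

lemma ideal_point_le:
  assumes "\<exists>y\<in>X. \<forall>z\<in>X. f y $ l \<le> f z $ l" "x \<in> X"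
  shows "ideal_point X f $ l \<le> f x $ l"
proof -
  from assms(1) obtain y where y: "y \<in> X" "\<And>z. z \<in> X \<Longrightarrow> f y $ l \<le> f z $ l"
    by blast
  then have "ideal_point X f $ l = f y $ l"
    unfolding ideal_point_def by (simp add: LEAST_image)
  with y assms(2) show ?thesis
    by simp
qed

text \<open>The maximum of finitely many linear forms is continuous and the admissible directions
  form a compact set, so the minimum exists; the zero direction has slope 0, which fixes the
  sign.\<close>

lemma criticality_attained:
  fixes f :: "real ^ 'n \<Rightarrow> real ^ 'k"
  assumes "closed X" "x \<in> X"
  obtains d where "x + d \<in> X" "infnorm d \<le> 1" "max_slope f x d = - criticality X f x"
    "criticality X f x \<ge> 0"
proof -
  define S where "S = {d. x + d \<in> X \<and> infnorm d \<le> 1}"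
  have "S = (\<lambda>y. y - x) ` {y \<in> X. infnorm (y - x) \<le> 1}"
  proof (rule set_eqI)
    fix d
    show "d \<in> S \<longleftrightarrow> d \<in> (\<lambda>y. y - x) ` {y \<in> X. infnorm (y - x) \<le> 1}"
      by (auto simp: S_def intro!: image_eqI[of _ _ "x + d"])
  qed
  moreover have "compact \<dots>"
    by (intro compact_continuous_image continuous_intros compact_Int_infnorm_ball assms)
  ultimately have "compact S"
    by simp
  moreover have "0 \<in> S"
    using assms by (simp add: S_def infnorm_0)
  moreover have "continuous_on S (max_slope f x)"
    unfolding max_slope_def
    by (rule continuous_on_Max_image) (auto intro!: continuous_intros)
  ultimately obtain d where d: "d \<in> S" "\<And>z. z \<in> S \<Longrightarrow> max_slope f x d \<le> max_slope f x z"
    using continuous_attains_inf[of S "max_slope f x"] by blast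
  have eq: "max_slope f x d = - criticality X f x"
    unfolding criticality_def S_def[symmetric] by (simp add: LEAST_image[of d S "max_slope f x", OF d])
  have "max_slope f x 0 = 0"
    by (simp add: max_slope_def)
  with d(2)[OF \<open>0 \<in> S\<close>] eq have "criticality X f x \<ge> 0"
    by simp
  with d eq that show thesis
    by (auto simp: S_def)
qed

text \<open>\<open>hessian_bound\<close> uses \<open>GREATEST\<close>, so it dominates the Hessian
  norms only once the maximum is known to be attained; compactness of \<open>B\<close> and
  continuity of the Hessian ensure this.\<close>

lemma norm_hessian_le_hessian_bound:
  fixes f :: "real ^ 'n \<Rightarrow> real ^ 'k"
  assumes "compact B" "B \<subseteq> U" "C2_on U f" "y \<in> B"
  shows "norm (hessian (\<lambda>y. f y $ l) y) \<le> hessian_bound B f"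
proof -
  define h where "h = (\<lambda>l y. norm (hessian (\<lambda>y. f y $ l) y))"
  have "continuous_on U (hessian (\<lambda>y. f y $ l))"
    using assms(3) by (simp add: C2_on_def)
  then have "continuous_on B (h l)"
    unfolding h_def using assms(2) by (intro continuous_on_norm) (rule continuous_on_subset)
  then obtain z where z: "z \<in> B" "\<And>y. y \<in> B \<Longrightarrow> h l y \<le> h l z"
    using continuous_attains_sup[of B "h l"] assms(1,4) by blast
  then have "h l y \<le> (GREATEST v. v \<in> h l ` B)"
    using assms(4) by (simp add: GREATEST_image)
  also have "\<dots> \<le> (MAX l. GREATEST v. v \<in> h l ` B)"
    by (rule Max_ge) auto
  finally show ?thesis
    by (simp add: h_def hessian_bound_def)
qed

section \<open>Decrease at Pascoletti-Serafini solutions\<close>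

lemma max_component_mono:
  fixes f :: "real ^ 'n \<Rightarrow> real ^ 'k"
  assumes "\<And>l. f y $ l \<le> f x $ l - a"
  shows "max_component f y \<le> max_component f x - a"
proof -
  have "f y $ l \<le> max_component f x - a" for l
  proof -
    have "f x $ l \<le> max_component f x"
      unfolding max_component_def by (rule Max_ge) auto
    with assms[of l] show ?thesis by simp
  qed
  then show ?thesis
    unfolding max_component_def[of f y] by (intro Max.boundedI) auto
qed

text \<open>The point \<open>y\<close> limits the optimal \<tau>, and the ratio bound transfers its
  decrease to \<open>xp\<close> at the cost of the factor \<rho>. How \<open>y\<close> was found is
  irrelevant here.\<close>

lemma PS_decrease:
  fixes m :: "real ^ 'n \<Rightarrow> real ^ 'k" and r :: "real ^ 'k"
  assumes PS: "PS_solution B m x r (\<tau>, xp)"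
    and r: "\<And>l. r $ l \<ge> 0"
    and ratio: "(MIN l. r $ l) / (MAX l. r $ l) \<ge> \<rho>" "\<rho> > 0"
    and y: "y \<in> B" "\<And>l. m y $ l \<le> m x $ l - a" "a \<ge> 0"
  shows "max_component m xp \<le> max_component m x - \<rho> * a"
proof -
  define R where "R = (MAX l. r $ l)"
  have rR: "r $ l \<le> R" for l
    unfolding R_def by (rule Max_ge) auto
  \<comment> \<open>For \<open>R = 0\<close> the quotient is 0 by the convention for division,
    against \<open>\<rho> > 0\<close>.\<close>
  have "R \<noteq> 0"
    using ratio unfolding R_def by (metis div_by_0 not_less)
  moreover have "R \<ge> 0"
    using r rR by (meson order_trans)
  ultimately have "R > 0"
    by simp
  have \<rho>r: "\<rho> * R \<le> r $ l" for l
  proof -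
    have "\<rho> * R \<le> (MIN l. r $ l)"
      using ratio \<open>R > 0\<close> by (simp add: R_def pos_le_divide_eq)
    also have "\<dots> \<le> r $ l"
      by (rule Min_le) auto
    finally show ?thesis .
  qed
  \<comment> \<open>Since no entry of \<open>r\<close> exceeds \<open>R\<close>, lowering \<tau> to
    \<open>- (a / R)\<close> costs each constraint at most \<open>a\<close>, which \<open>y\<close>
    provides.\<close>
  have "a / R * r $ l \<le> a" for l
    using mult_left_mono[OF rR[of l], of "a / R"] \<open>R > 0\<close> y(3) by simp
  then have "m x $ l + (- (a / R)) * r $ l - m y $ l \<ge> 0" for l
    using y(2)[of l] by (smt (verit) mult_minus_left)
  then have "m x + (- (a / R)) *\<^sub>R r - m y \<ge> 0"
    by (simp add: less_eq_vec_def)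
  with PS y(1) have "\<not> - (a / R) < \<tau>"
    unfolding PS_solution_def is_arg_min_def by fastforce
  then have \<tau>: "\<tau> \<le> - (a / R)"
    by simp
  have sol: "m x $ l + \<tau> * r $ l - m xp $ l \<ge> 0" for l
    using PS by (auto simp: PS_solution_def is_arg_min_def less_eq_vec_def)
  have "m xp $ l \<le> m x $ l - \<rho> * a" for l
  proof -
    \<comment> \<open>The upper bound on \<tau> keeps its direction because \<open>r\<close> is
      nonnegative; \<open>\<rho> * R\<close> then bounds each entry of \<open>r\<close> from
      below.\<close>
    have "\<tau> * r $ l \<le> - (a / R) * r $ l"
      using \<tau> r[of l] by (rule mult_right_mono)
    moreover have "\<rho> * a \<le> a / R * r $ l"
      using mult_left_mono[OF \<rho>r[of l], of "a / R"] \<open>R > 0\<close> y(3) by (simp add: mult.commute)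
    ultimately show ?thesis
      using sol[of l] by linarith
  qed
  then show ?thesis
    by (rule max_component_mono)
qed

text \<open>The pair \<open>(0, x)\<close> is feasible. This serves the case of zero criticality,
  where the ratio bound is not at hand.\<close>

lemma PS_nonincreasing:
  fixes m :: "real ^ 'n \<Rightarrow> real ^ 'k" and r :: "real ^ 'k"
  assumes PS: "PS_solution B m x r (\<tau>, xp)" and r: "\<And>l. r $ l \<ge> 0" and "x \<in> B"
  shows "max_component m xp \<le> max_component m x"
proof -
  have "\<not> 0 < \<tau>"
    using PS \<open>x \<in> B\<close> by (auto simp: PS_solution_def is_arg_min_def dest: spec[of _ 0] spec[of _ x])
  then have "\<tau> * r $ l \<le> 0" for l
    using r[of l] by (simp add: mult_nonpos_nonneg)
  moreover have "m x $ l + \<tau> * r $ l - m xp $ l \<ge> 0" for l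
    using PS by (auto simp: PS_solution_def is_arg_min_def less_eq_vec_def)
  ultimately have "m xp $ l \<le> m x $ l - 0" for l
    by (smt (verit))
  from max_component_mono[of m, OF this] show ?thesis
    by simp
qed

section \<open>Step length and descent inside the trust region\<close>

lemma step_bound_pos:
  assumes "\<omega> > 0" "c > 0" "H \<ge> 0" "\<Delta> > 0"
  shows "step_bound \<omega> c H \<Delta> > 0"
  using assms by (auto simp: step_bound_def)

lemma step_bound_le:
  shows "step_bound \<omega> c H \<Delta> \<le> \<Delta>" "step_bound \<omega> c H \<Delta> \<le> 1"
    "H \<noteq> 0 \<Longrightarrow> step_bound \<omega> c H \<Delta> \<le> \<omega> / (c * H)"
  by (auto simp: step_bound_def)

text \<open>The first conclusion makes the ratio hypothesis applicable; the second supplies the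
  comparison point for \<open>PS_decrease\<close>.\<close>

lemma trust_region_decrease:
  fixes m :: "real ^ 'n \<Rightarrow> real ^ 'k"
  assumes X: "closed X" "convex X" "x \<in> X" "\<Delta> > 0"
    and U: "X \<subseteq> U" "C2_on U m"
    and c: "c > 0" "\<And>z :: real ^ 'n. norm z \<le> sqrt c * infnorm z"
    and \<omega>: "\<omega> = criticality X m x" "\<omega> > 0"
    and B: "B = trust_region X x \<Delta>"
    and s: "s = step_bound \<omega> c (hessian_bound B m) \<Delta>"
  shows "\<not> pareto_critical B m x" "\<exists>y\<in>B. \<forall>l. m y $ l \<le> m x $ l - \<omega> * s / 2" "s > 0"
proof -
  obtain d where d: "x + d \<in> X" "infnorm d \<le> 1" "max_slope m x d = - \<omega>"
    using criticality_attained[of X x m] X(1,3) \<omega>(1) by metis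
  define H where "H = hessian_bound B m"
  have compB: "compact B"
    unfolding B trust_region_def by (rule compact_Int_infnorm_ball[OF X(1)])
  have BU: "B \<subseteq> U"
    using U(1) by (auto simp: B trust_region_def)
  have "x \<in> B"
    using X by (simp add: B trust_region_def infnorm_0)
  have hess: "norm (hessian (\<lambda>y. m y $ l) y) \<le> H" if "y \<in> B" for l y
    unfolding H_def by (rule norm_hessian_le_hessian_bound[OF compB BU U(2) that])
  have "H \<ge> 0"
    using hess[OF \<open>x \<in> B\<close>] norm_ge_zero order_trans by blast
  show "s > 0"
    unfolding s H_def[symmetric] by (rule step_bound_pos) (fact \<omega> c \<open>H \<ge> 0\<close> X)+
  have s_le: "s \<le> \<Delta>" "s \<le> 1" "H \<noteq> 0 \<Longrightarrow> s \<le> \<omega> / (c * H)"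
    unfolding s H_def[symmetric] by (auto intro: step_bound_le)
  \<comment> \<open>Convexity uses \<open>s \<le> 1\<close>, the radius uses
    \<open>s \<le> \<Delta>\<close>.\<close>
  have seg: "x + u *\<^sub>R d \<in> B" if "0 \<le> u" "u \<le> s" for u
  proof -
    have "(1 - u) *\<^sub>R x + u *\<^sub>R (x + d) \<in> X"
      using X d(1) that s_le by (intro convexD) auto
    moreover have "(1 - u) *\<^sub>R x + u *\<^sub>R (x + d) = x + u *\<^sub>R d"
      by (simp add: algebra_simps)
    moreover have "infnorm (u *\<^sub>R d) \<le> \<Delta>"
      using that s_le mult_mono[of u s "infnorm d" 1] d(2) \<open>s > 0\<close>
      by (simp add: infnorm_mul infnorm_pos_le)
    ultimately show ?thesis
      by (simp add: B trust_region_def)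
  qed
  have slope: "grad (\<lambda>y. m y $ l) x \<bullet> d \<le> - \<omega>" for l
    unfolding d(3)[symmetric] max_slope_def by (rule Max_ge) auto
  \<comment> \<open>The direction is scaled because \<open>x + d\<close> itself may leave
    \<open>B\<close> when \<open>\<Delta> < 1\<close>.\<close>
  have "max_slope m x (s *\<^sub>R d) < 0"
  proof -
    have "s * (grad (\<lambda>y. m y $ l) x \<bullet> d) < 0" for l
      using slope[of l] \<omega>(2) \<open>s > 0\<close> by (simp add: mult_pos_neg)
    then show ?thesis
      by (simp add: max_slope_def)
  qed
  then show "\<not> pareto_critical B m x"
    using seg[of s] \<open>s > 0\<close> by (auto simp: pareto_critical_def)
  \<comment> \<open>The Taylor bound uses the Euclidean norm but criticality uses
    \<open>infnorm\<close>; the conversion is the source of \<open>c\<close> in the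
    quotient.\<close>
  have "norm d \<le> sqrt c"
    using order_trans[OF c(2)[of d] mult_left_mono[OF d(2)]] c(1) by simp
  then have "(norm d)\<^sup>2 \<le> c"
    using c(1) power_mono[of "norm d" "sqrt c" 2] by simp
  then have Hd: "H * (norm d)\<^sup>2 \<le> H * c"
    using \<open>H \<ge> 0\<close> by (rule mult_left_mono)
  \<comment> \<open>For \<open>H = 0\<close> the quotient is absent from \<open>step_bound\<close>,
    and the claim reduces to \<open>0 \<le> \<omega>\<close>.\<close>
  have "s * (c * H) \<le> \<omega>"
  proof (cases "H = 0")
    case False
    then show ?thesis
      using s_le(3) \<open>H \<ge> 0\<close> c(1) by (simp add: pos_le_divide_eq)
  qed (use \<omega> in simp)
  then have "s * (s * (c * H)) \<le> s * \<omega>"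
    using \<open>s > 0\<close> by simp
  moreover have "s\<^sup>2 / 2 * (H * (norm d)\<^sup>2) \<le> s\<^sup>2 / 2 * (H * c)"
    using Hd by (rule mult_left_mono) simp
  \<comment> \<open>The quadratic term consumes at most half of the linear decrease
    \<open>s * \<omega>\<close>; hence the factor 1/2.\<close>
  ultimately have quad: "s\<^sup>2 / 2 * (H * (norm d)\<^sup>2) \<le> \<omega> * s / 2"
    by (simp add: power2_eq_square algebra_simps)
  have "m (x + s *\<^sub>R d) $ l \<le> m x $ l - \<omega> * s / 2" for l
  proof -
    have "m (x + s *\<^sub>R d) $ l \<le> m x $ l + s * (grad (\<lambda>y. m y $ l) x \<bullet> d)
        + s\<^sup>2 / 2 * (H * (norm d)\<^sup>2)"
    proof (rule second_order_upper_bound[of s "\<lambda>y. m y $ l"])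
      fix u assume u: "0 \<le> u" "u \<le> s"
      from seg[OF u] BU have "x + u *\<^sub>R d \<in> U"
        by blast
      then show "(\<lambda>y. m y $ l) differentiable at (x + u *\<^sub>R d)"
        and "grad (\<lambda>y. m y $ l) differentiable at (x + u *\<^sub>R d)"
        using U(2) by (auto simp: C2_on_def)
      show "norm (hessian (\<lambda>y. m y $ l) (x + u *\<^sub>R d)) \<le> H"
        by (rule hess[OF seg[OF u]])
    qed fact
    moreover have "s * (grad (\<lambda>y. m y $ l) x \<bullet> d) \<le> s * - \<omega>"
      using slope[of l] \<open>s > 0\<close> by (intro mult_left_mono) auto
    ultimately show ?thesis
      using quad by (simp add: mult.commute)
  qed
  then show "\<exists>y\<in>B. \<forall>l. m y $ l \<le> m x $ l - \<omega> * s / 2"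
    using seg[of s] \<open>s > 0\<close> by (intro bexI[of _ "x + s *\<^sub>R d"]) auto
qed

section \<open>Sufficient decrease uniformly in the iteration index\<close>

theorem lemmaA1:
  fixes X :: "(real ^ 'n) set"
    and x :: "nat \<Rightarrow> real ^ 'n"
    and \<Delta> :: "nat \<Rightarrow> real"
    and m :: "nat \<Rightarrow> real ^ 'n \<Rightarrow> real ^ 'k"
    and r :: "nat \<Rightarrow> real ^ 'k"
    and B :: "nat \<Rightarrow> (real ^ 'n) set"
    and c \<rho> :: real
  assumes X: "X = UNIV \<or> closed X \<and> bounded X \<and> convex X"
    and x: "\<And>t. x t \<in> X"
    and \<Delta>: "\<And>t. \<Delta> t > 0"
    and m: "\<And>t. \<exists>U. open U \<and> X \<subseteq> U \<and> C2_on U (m t)"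
    and c: "c > 0" "\<And>z :: real ^ 'n. norm z \<le> sqrt c * infnorm z"
    and B: "\<And>t. B t = trust_region X (x t) (\<Delta> t)"
    and min_exists: "\<And>t l. \<exists>y\<in>X. \<forall>z\<in>X. m t y $ l \<le> m t z $ l"
    and r: "\<And>t. r t = m t (x t) - ideal_point X (m t)"
    and \<rho>: "0 < \<rho>" "\<rho> \<le> 1"
    and ratio: "\<And>t. \<not> pareto_critical (B t) (m t) (x t) \<Longrightarrow>
                  (MIN l. r t $ l) / (MAX l. r t $ l) \<ge> \<rho>"
  shows "\<exists>\<kappa>. 0 < \<kappa> \<and> \<kappa> < 1 \<and>
    (\<forall>t \<tau> xp. PS_solution (B t) (m t) (x t) (r t) (\<tau>, xp) \<longrightarrow>
       max_component (m t) (x t) - max_component (m t) xp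
         \<ge> \<kappa> * criticality X (m t) (x t)
             * step_bound (criticality X (m t) (x t)) c (hessian_bound (B t) (m t)) (\<Delta> t))"
\<comment> \<open>The witness is fixed before \<open>t\<close>: 1/2 stems from the Taylor remainder,
  \<rho> from the ratio bound.\<close>
proof (intro exI[of _ "\<rho> / 2"] conjI allI impI)
  show "0 < \<rho> / 2" "\<rho> / 2 < 1"
    using \<rho> by auto
next
  fix t \<tau> xp
  assume PS: "PS_solution (B t) (m t) (x t) (r t) (\<tau>, xp)"
  define \<omega> where "\<omega> = criticality X (m t) (x t)"
  define s where "s = step_bound \<omega> c (hessian_bound (B t) (m t)) (\<Delta> t)"
  \<comment> \<open>Both alternatives for \<open>X\<close> are treated alike as closed convex
    sets.\<close>
  have X': "closed X" "convex X"
    using X by auto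
  have r_nonneg: "r t $ l \<ge> 0" for l
    using ideal_point_le[where X = X and f = "m t" and l = l and x = "x t"] min_exists x
    by (simp add: r)
  have "max_component (m t) xp \<le> max_component (m t) (x t) - \<rho> / 2 * \<omega> * s"
  proof (cases "\<omega> = 0")
    case True
    \<comment> \<open>The claimed decrease is 0 here, so it is enough that the maximum does not
      increase.\<close>
    have "x t \<in> B t"
      using x[of t] \<Delta>[of t] by (simp add: B trust_region_def infnorm_0)
    from PS_nonincreasing[OF PS r_nonneg this] True show ?thesis
      by simp
  next
    case False
    moreover have "\<omega> \<ge> 0"
      using criticality_attained[OF X'(1) x, of t "m t"] unfolding \<omega>_def by metis
    ultimately have "\<omega> > 0"
      by simp
    obtain U where U: "X \<subseteq> U" "C2_on U (m t)"
      using m by blast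
    note step = trust_region_decrease[OF X' x \<Delta> U c \<omega>_def \<open>\<omega> > 0\<close> B s_def]
    from step(2) obtain y where y: "y \<in> B t" "\<And>l. m t y $ l \<le> m t (x t) $ l - \<omega> * s / 2"
      by blast
    have "\<omega> * s / 2 \<ge> 0"
      using \<open>\<omega> > 0\<close> step(3) by simp
    \<comment> \<open>Positive criticality has excluded Pareto-criticality, so \<open>ratio\<close>
      applies; the decrease used is \<open>a = \<omega> * s / 2\<close>.\<close>
    from PS_decrease[OF PS r_nonneg ratio[OF step(1)] \<rho>(1) y this] show ?thesis
      by (simp add: mult.assoc)
  qed
  then show "max_component (m t) (x t) - max_component (m t) xp
      \<ge> \<rho> / 2 * criticality X (m t) (x t)
          * step_bound (criticality X (m t) (x t)) c (hessian_bound (B t) (m t)) (\<Delta> t)"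
    by (simp add: \<omega>_def s_def)
qed

end
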